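(* Let $t>0$ and let $c_n=t\,b_n^{t-2}$, $d_n=b_n^t$. Assume that $\lim_{n\to\infty} b_n^2(1-\rho_n)=2\lambda^2$ with $\lambda\in(0,\infty)$. Then for all $x,y\in\mathbb{R}$, $$\lim_{n\to\infty}\mathbb{P}\left(|M_{n1}|^t\le c_n x+d_n,\ |M_{n2}|^t\le c_n y+d_n\right)=H_\lambda(x,y).$$
   Context: $\Phi$ denotes the standard Gaussian distribution function. The constant $b_n$ is defined by $1-\Phi(b_n)=n^{-1}$. $\{(X_{ni},Y_{ni}),1\le i\le n,n\ge1\}$ is a triangular array of independent bivariate Gaussian random vectors with $E X_{ni}=E Y_{ni}=0$, $\mathrm{Var}\,X_{ni}=\mathrm{Var}\,Y_{ni}=1$ and $\mathrm{Cov}(X_{ni},Y_{ni})=\rho_n$ for $1\le i\le n$. The componentwise maxima are $M_{n1}=\max_{1\le i\le n}X_{ni}$ and $M_{n2}=\max_{1\le i\le n}Y_{ni}$. For $\lambda\in(0,\infty)$ the Hüsler–Reiss distribution is $$H_\lambda(x,y)=\exp\left(-\Phi\left(\lambda+\frac{x-y}{2\lambda}\right)e^{-y}-\Phi\left(\lambda+\frac{y-x}{2\lambda}\right)e^{-x}\right),\quad x,y\in\mathbb{R}.$$ *)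

theory Defs
  imports "HOL-Probability.Probability"
begin

definition Phi :: "real \<Rightarrow> real" where
  "Phi = cdf std_normal_distribution"

text \<open>The normal laws on the real line include the point masses (variance zero).\<close>

definition normal_law :: "real \<Rightarrow> real \<Rightarrow> real measure" where
  "normal_law \<mu> \<sigma> =
     (if \<sigma> = 0 then return borel \<mu> else density lborel (\<lambda>x. ennreal (normal_density \<mu> \<sigma> x)))"

definition gaussian_var :: "'a measure \<Rightarrow> ('a \<Rightarrow> real) \<Rightarrow> bool" where
  "gaussian_var M X \<longleftrightarrow>
     X \<in> borel_measurable M \<and> (\<exists>\<mu> \<sigma>. 0 \<le> \<sigma> \<and> distr M borel X = normal_law \<mu> \<sigma>)"

text \<open>A random vector is Gaussian when all linear combinations of its coordinates are Gaussian;
  degenerate vectors (correlation 1 or -1) are included.\<close>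

definition gaussian_pair :: "'a measure \<Rightarrow> ('a \<Rightarrow> real) \<Rightarrow> ('a \<Rightarrow> real) \<Rightarrow> bool" where
  "gaussian_pair M X Y \<longleftrightarrow> (\<forall>u v. gaussian_var M (\<lambda>\<omega>. u * X \<omega> + v * Y \<omega>))"

definition covariance :: "'a measure \<Rightarrow> ('a \<Rightarrow> real) \<Rightarrow> ('a \<Rightarrow> real) \<Rightarrow> real" where
  "covariance M X Y =
     prob_space.expectation M
       (\<lambda>\<omega>. (X \<omega> - prob_space.expectation M X) * (Y \<omega> - prob_space.expectation M Y))"

definition row_max :: "(nat \<Rightarrow> nat \<Rightarrow> 'a \<Rightarrow> real) \<Rightarrow> nat \<Rightarrow> 'a \<Rightarrow> real" where
  "row_max X n \<omega> = Max ((\<lambda>i. X n i \<omega>) ` {1..n})"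

text \<open>Only the vectors within one row are required to be independent; nothing is assumed
  about the joint law of different rows.\<close>

definition gaussian_array ::
  "'a measure \<Rightarrow> (nat \<Rightarrow> nat \<Rightarrow> 'a \<Rightarrow> real) \<Rightarrow> (nat \<Rightarrow> nat \<Rightarrow> 'a \<Rightarrow> real) \<Rightarrow> (nat \<Rightarrow> real) \<Rightarrow> bool"
where
  "gaussian_array M X Y \<rho> \<longleftrightarrow>
     (\<forall>n\<ge>1. prob_space.indep_vars M (\<lambda>_. borel) (\<lambda>i \<omega>. (X n i \<omega>, Y n i \<omega>)) {1..n} \<and>
       (\<forall>i\<in>{1..n}.
          gaussian_pair M (X n i) (Y n i) \<and>
          prob_space.expectation M (X n i) = 0 \<and> prob_space.expectation M (Y n i) = 0 \<and>
          prob_space.variance M (X n i) = 1 \<and> prob_space.variance M (Y n i) = 1 \<and>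
          covariance M (X n i) (Y n i) = \<rho> n))"

definition husler_reiss :: "real \<Rightarrow> real \<Rightarrow> real \<Rightarrow> real" where
  "husler_reiss l x y =
     exp (- Phi (l + (x - y) / (2 * l)) * exp (- y) - Phi (l + (y - x) / (2 * l)) * exp (- x))"

end

theory Submission
  imports Defs "HOL-Real_Asymp.Real_Asymp"
begin

text \<open>
  Write $u_n(x) = (c_n x + d_n)^{1/t}$, so that $b_n (u_n(x) - b_n) \to x$. Since the maxima fall below
  $-u_n$ with vanishing probability, the absolute values are irrelevant and the probability
  is asymptotically $(1 - q_n)^n$ with $q_n = P(Y > u_n(y)) + P(X > u_n(x), Y \le u_n(y))$.
  For $|\rho_n| < 1$, $Y = \rho_n X + \sqrt{1 - \rho_n^2}\, Z$ with $Z$ independent of $X$; the independence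
  follows from the one-dimensional Levy uniqueness theorem, applied first to the law of $X$ weighted by
  functions of $Z$ and then to the law of $Z$ restricted to events $X \in A$. Conditioning on
  $X = b_n + z / b_n$ and using $n \varphi(b_n) / b_n \to 1$, dominated convergence gives
  $n q_n \to e^{-y} + \int_x^\infty e^{-z} \Phi(\lambda + (y - z) / (2 \lambda))\, dz$, and the integral has an explicit
  antiderivative.
\<close>

section \<open>Joint laws from characteristic functions\<close>

text \<open>Dividing \<open>w\<close> by its expectation gives a probability density. Under the
  reweighted measure \<open>X\<close> has the characteristic function of \<open>\<mu>\<close>, so
  Levy uniqueness identifies its law. A weight depending on a second variable thus encodes joint
  information in a one-dimensional statement.\<close>

lemma (in prob_space) weighted_law_eq:
  fixes X w :: "'a \<Rightarrow> real"
  assumes [measurable]: "X \<in> borel_measurable M"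
    and w: "integrable M w" "\<And>\<omega>. 0 \<le> w \<omega>"
    and \<mu>: "real_distribution \<mu>"
    and char: "\<And>u. (CLINT \<omega>|M. w \<omega> *\<^sub>R iexp (u * X \<omega>)) = expectation w *\<^sub>R char \<mu> u"
    and A[measurable]: "A \<in> sets borel"
  shows "expectation (\<lambda>\<omega>. w \<omega> * indicator A (X \<omega>)) = expectation w * measure \<mu> A"
\<comment> \<open>A weight of expectation zero cannot be normalised, but it vanishes almost
  everywhere, so both sides are zero.\<close>
proof (cases "expectation w = 0")
  case True
  then have "AE \<omega> in M. w \<omega> = 0"
    using integral_nonneg_eq_0_iff_AE[OF w(1)] w(2) by auto
  then have "expectation (\<lambda>\<omega>. w \<omega> * indicator A (X \<omega>)) = expectation (\<lambda>_. 0)"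
    using w(1) by (intro integral_cong_AE) auto
  with True show ?thesis by simp
next
  case False
  define e where "e = expectation w"
  have e: "e > 0"
    using False Bochner_Integration.integral_nonneg[of M w] w(2) unfolding e_def by (simp add: less_eq_real_def)
  have [measurable]: "w \<in> borel_measurable M" using w(1) by auto
  define M' where "M' = density M (\<lambda>\<omega>. ennreal (w \<omega> / e))"
  have sM'[measurable_cong]: "sets M' = sets M" by (simp add: M'_def)
  have spM': "space M' = space M" by (simp add: M'_def)
  have [measurable]: "X \<in> borel_measurable M'" by measurable
  have M': "prob_space M'"
  proof
    have "emeasure M' (space M') = (\<integral>\<^sup>+\<omega>. ennreal (w \<omega> / e) \<partial>M)"
      unfolding spM' unfolding M'_def by (subst emeasure_density) (auto intro!: nn_integral_cong)
    also have "\<dots> = ennreal (expectation (\<lambda>\<omega>. w \<omega> / e))"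
      using w e by (intro nn_integral_eq_integral) auto
    finally show "emeasure M' (space M') = 1" using e by (simp add: e_def)
  qed
  interpret M': prob_space M' by fact
  interpret \<mu>: real_distribution \<mu> by fact
  define N where "N = distr M' borel X"
  have N: "real_distribution N"
    unfolding N_def by (rule M'.real_distribution_distr) simp
  have "char N u = char \<mu> u" for u
  proof -
    have "char N u = (CLINT \<omega>|M'. iexp (u * X \<omega>))"
      unfolding char_def N_def by (subst integral_distr) auto
    also have "\<dots> = (CLINT \<omega>|M. (w \<omega> / e) *\<^sub>R iexp (u * X \<omega>))"
      unfolding M'_def by (subst integral_density) (use w e in auto)
    also have "\<dots> = (CLINT \<omega>|M. (1 / e) *\<^sub>R w \<omega> *\<^sub>R iexp (u * X \<omega>))"
      by (intro Bochner_Integration.integral_cong) auto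
    also have "\<dots> = (1 / e) *\<^sub>R (CLINT \<omega>|M. w \<omega> *\<^sub>R iexp (u * X \<omega>))"
      by (rule integral_scaleR_right)
    also have "\<dots> = char \<mu> u"
      using e by (subst char) (simp add: e_def[symmetric])
    finally show ?thesis .
  qed
  then have "N = \<mu>"
    using Levy_uniqueness[OF N \<mu>] by auto
  then have "measure \<mu> A = measure N A" by simp
  also have "\<dots> = (LINT p|N. indicator A p)"
    by (simp add: N_def)
  also have "\<dots> = (LINT \<omega>|M'. indicator A (X \<omega>))"
    unfolding N_def by (subst integral_distr) auto
  also have "\<dots> = (LINT \<omega>|M. (w \<omega> / e) *\<^sub>R indicator A (X \<omega>))"
    unfolding M'_def by (subst integral_density) (use w e in auto)
  also have "\<dots> = (LINT \<omega>|M. (w \<omega> * indicator A (X \<omega>)) / e)"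
    by simp
  also have "\<dots> = expectation (\<lambda>\<omega>. w \<omega> * indicator A (X \<omega>)) / e"
    by (rule integral_divide_zero)
  finally show ?thesis using e by (simp add: e_def field_simps)
qed

lemma cos_eq_iexp: "complex_of_real (cos \<theta>) = (iexp \<theta> + iexp (- \<theta>)) / 2"
  by (simp add: cos_of_real[symmetric] cos_exp_eq)

lemma sin_eq_iexp: "complex_of_real (sin \<theta>) = (iexp \<theta> - iexp (- \<theta>)) / (2 * \<i>)"
  by (simp add: sin_of_real[symmetric] sin_exp_eq)

text \<open>Uniqueness in the plane is reduced to the line by separating one variable at a time.
  Weighting by \<open>cos (v * Z \<omega>)\<close> and \<open>sin (v * Z \<omega>)\<close> turns the
  frequency \<open>u\<close> into a set \<open>A\<close>; weighting by the indicator of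
  \<open>A\<close> at \<open>X\<close> then turns the frequency \<open>v\<close> into a set
  \<open>B\<close>. Rectangles determine the product measure.\<close>

lemma (in prob_space) product_law_of_char:
  fixes X Z :: "'a \<Rightarrow> real"
  assumes [measurable]: "X \<in> borel_measurable M" "Z \<in> borel_measurable M"
    and \<mu>: "real_distribution \<mu>" and \<nu>: "real_distribution \<nu>"
    and char: "\<And>u v. (CLINT \<omega>|M. iexp (u * X \<omega> + v * Z \<omega>)) = char \<mu> u * char \<nu> v"
  shows "distr M (borel \<Otimes>\<^sub>M borel) (\<lambda>\<omega>. (X \<omega>, Z \<omega>)) = \<mu> \<Otimes>\<^sub>M \<nu>"
proof -
  interpret \<mu>: real_distribution \<mu> by fact
  interpret \<nu>: real_distribution \<nu> by fact
  have int_exp: "integrable M (\<lambda>\<omega>. iexp (u * X \<omega> + v * Z \<omega>))" for u v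
    by (rule integrable_const_bound[of _ 1]) (auto intro!: AE_I2)
  \<comment> \<open>Conjugate symmetry makes the values at \<open>v\<close> and \<open>- v\<close>
    combine to the real part in the cosine case and to the imaginary part in the sine case.\<close>
  have char_minus: "char \<nu> (- v) = cnj (char \<nu> v)" for v
    unfolding char_def by (simp add: exp_cnj flip: Bochner_Integration.integral_cnj)
  have cos_char: "(CLINT \<omega>|M. cos (v * Z \<omega>) *\<^sub>R iexp (u * X \<omega>)) = Re (char \<nu> v) *\<^sub>R char \<mu> u" for u v
  proof -
    have "(CLINT \<omega>|M. cos (v * Z \<omega>) *\<^sub>R iexp (u * X \<omega>))
        = (CLINT \<omega>|M. (iexp (u * X \<omega> + v * Z \<omega>) + iexp (u * X \<omega> + (- v) * Z \<omega>)) / 2)"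
      by (intro Bochner_Integration.integral_cong)
         (auto simp: scaleR_conv_of_real cos_eq_iexp exp_add[symmetric] algebra_simps add_divide_distrib)
    also have "\<dots> = (char \<mu> u * char \<nu> v + char \<mu> u * char \<nu> (- v)) / 2"
      using int_exp by (subst integral_divide_zero, subst Bochner_Integration.integral_add) (simp_all only: char)
    also have "\<dots> = Re (char \<nu> v) *\<^sub>R char \<mu> u"
      by (simp add: char_minus complex_eq_iff field_simps)
    finally show ?thesis .
  qed
  have sin_char: "(CLINT \<omega>|M. sin (v * Z \<omega>) *\<^sub>R iexp (u * X \<omega>)) = Im (char \<nu> v) *\<^sub>R char \<mu> u" for u v
  proof -
    have "(CLINT \<omega>|M. sin (v * Z \<omega>) *\<^sub>R iexp (u * X \<omega>))
        = (CLINT \<omega>|M. (iexp (u * X \<omega> + v * Z \<omega>) - iexp (u * X \<omega> + (- v) * Z \<omega>)) / (2 * \<i>))"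
      by (intro Bochner_Integration.integral_cong)
         (auto simp: scaleR_conv_of_real sin_eq_iexp exp_add[symmetric] algebra_simps diff_divide_distrib)
    also have "\<dots> = (char \<mu> u * char \<nu> v - char \<mu> u * char \<nu> (- v)) / (2 * \<i>)"
      using int_exp by (subst integral_divide_zero, subst Bochner_Integration.integral_diff) (simp_all only: char)
    also have "\<dots> = Im (char \<nu> v) *\<^sub>R char \<mu> u"
      by (simp add: char_minus right_diff_distrib[symmetric] complex_diff_cnj scaleR_conv_of_real)
         (simp add: complex_eq_iff)
    finally show ?thesis .
  qed
  have bounded: "integrable M (\<lambda>\<omega>. f (v * Z \<omega>))"
    if "\<And>\<theta>. \<bar>f \<theta>\<bar> \<le> 1" "f \<in> borel_measurable borel" for f :: "real \<Rightarrow> real" and v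
    using that by (intro integrable_const_bound[of _ 1]) (auto intro!: AE_I2)
  have plain: "(CLINT \<omega>|M. iexp (u * X \<omega>)) = char \<mu> u" for u
    using char[of u 0] \<nu>.char_zero by simp
  \<comment> \<open>The constant weight 1 shows that \<open>X\<close> itself has law
    \<open>\<mu>\<close>.\<close>
  have base: "expectation (\<lambda>\<omega>. indicator A (X \<omega>)) = measure \<mu> A" if "A \<in> sets borel" for A
    using weighted_law_eq[where w = "\<lambda>_. 1", OF _ _ _ \<mu>, of X A] that plain by (simp add: prob_space)
  \<comment> \<open>Levy uniqueness applies to probability measures only, so the weights cos and sin are shifted by 2.\<close>
  have shifted: "expectation (\<lambda>\<omega>. f (v * Z \<omega>) * indicator A (X \<omega>)) = r * measure \<mu> A"
    if f: "\<And>\<theta>. \<bar>f \<theta>\<bar> \<le> 1" "f \<in> borel_measurable borel"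
      and ch: "\<And>u. (CLINT \<omega>|M. f (v * Z \<omega>) *\<^sub>R iexp (u * X \<omega>)) = r *\<^sub>R char \<mu> u"
      and A[measurable]: "A \<in> sets borel" for f :: "real \<Rightarrow> real" and v r A
  proof -
    have [measurable]: "f \<in> borel_measurable borel" by fact
    have intf: "integrable M (\<lambda>\<omega>. f (v * Z \<omega>))" using bounded f by blast
    have iE: "integrable M (\<lambda>\<omega>. iexp (u * X \<omega>))" for u
      using int_exp[of u 0] by simp
    have ifE: "integrable M (\<lambda>\<omega>. f (v * Z \<omega>) *\<^sub>R iexp (u * X \<omega>))" for u
      using f by (intro integrable_const_bound[of _ 1]) (auto intro!: AE_I2)
    have ifA: "integrable M (\<lambda>\<omega>. f (v * Z \<omega>) * indicator A (X \<omega>))"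
      using f by (intro integrable_const_bound[of _ 1]) (auto intro!: AE_I2 split: split_indicator)
    have iA: "integrable M (\<lambda>\<omega>. indicator A (X \<omega>) :: real)"
      by (intro integrable_const_bound[of _ 1]) (auto intro!: AE_I2 split: split_indicator)
    \<comment> \<open>At frequency 0 the hypothesis on \<open>f\<close> says that \<open>r\<close>
      is the mean of the weight.\<close>
    have "complex_of_real (expectation (\<lambda>\<omega>. f (v * Z \<omega>))) = of_real r"
      using ch[of 0] \<mu>.char_zero by (simp add: scaleR_conv_of_real)
    then have r: "expectation (\<lambda>\<omega>. f (v * Z \<omega>)) = r" by (simp only: of_real_eq_iff)
    have E: "expectation (\<lambda>\<omega>. 2 + f (v * Z \<omega>)) = 2 + r"
      using intf by (simp add: prob_space r)
    have "expectation (\<lambda>\<omega>. (2 + f (v * Z \<omega>)) * indicator A (X \<omega>))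
        = expectation (\<lambda>\<omega>. 2 + f (v * Z \<omega>)) * measure \<mu> A"
    proof (rule weighted_law_eq[OF _ _ _ \<mu>])
      show "0 \<le> 2 + f (v * Z \<omega>)" for \<omega>
        using f(1)[of "v * Z \<omega>"] by linarith
      show "(CLINT \<omega>|M. (2 + f (v * Z \<omega>)) *\<^sub>R iexp (u * X \<omega>))
        = expectation (\<lambda>\<omega>. 2 + f (v * Z \<omega>)) *\<^sub>R char \<mu> u" for u
        unfolding E using iE[of u] ifE[of u]
        by (simp add: scaleR_add_left Bochner_Integration.integral_add ch plain del: of_real_mult)
    qed (use intf in auto)
    moreover have "expectation (\<lambda>\<omega>. (2 + f (v * Z \<omega>)) * indicator A (X \<omega>))
        = 2 * expectation (\<lambda>\<omega>. indicator A (X \<omega>)) + expectation (\<lambda>\<omega>. f (v * Z \<omega>) * indicator A (X \<omega>))"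
      using iA ifA by (simp add: distrib_right Bochner_Integration.integral_add)
    ultimately show ?thesis
      unfolding E using base[OF A] by (simp add: algebra_simps)
  qed
  have prod: "expectation (\<lambda>\<omega>. indicator A (X \<omega>) * indicator B (Z \<omega>)) = measure \<mu> A * measure \<nu> B"
    if [measurable]: "A \<in> sets borel" "B \<in> sets borel" for A B
  proof -
    have iA: "integrable M (\<lambda>\<omega>. indicator A (X \<omega>) :: real)"
      by (intro integrable_const_bound[of _ 1]) (auto intro!: AE_I2 split: split_indicator)
    have EA: "expectation (\<lambda>\<omega>. indicator A (X \<omega>)) = measure \<mu> A"
      using base by simp
    \<comment> \<open>Second use of uniqueness, now for the law of \<open>Z\<close> with the
      indicator of \<open>A\<close> as weight. The real and imaginary parts of the weighted
      characteristic function are the cosine and sine expectations supplied by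
      \<open>shifted\<close>.\<close>
    have "expectation (\<lambda>\<omega>. indicator A (X \<omega>) * indicator B (Z \<omega>))
        = expectation (\<lambda>\<omega>. indicator A (X \<omega>)) * measure \<nu> B"
    proof (rule weighted_law_eq[OF _ _ _ \<nu>])
      fix v
      have c: "expectation (\<lambda>\<omega>. cos (v * Z \<omega>) * indicator A (X \<omega>)) = Re (char \<nu> v) * measure \<mu> A"
        by (rule shifted) (simp_all add: cos_char del: of_real_mult)
      have s: "expectation (\<lambda>\<omega>. sin (v * Z \<omega>) * indicator A (X \<omega>)) = Im (char \<nu> v) * measure \<mu> A"
        by (rule shifted) (simp_all add: sin_char del: of_real_mult)
      have i: "integrable M (\<lambda>\<omega>. indicator A (X \<omega>) *\<^sub>R iexp (v * Z \<omega>))"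
        by (intro integrable_const_bound[of _ 1]) (auto intro!: AE_I2 split: split_indicator)
      show "(CLINT \<omega>|M. indicator A (X \<omega>) *\<^sub>R iexp (v * Z \<omega>))
          = expectation (\<lambda>\<omega>. indicator A (X \<omega>)) *\<^sub>R char \<nu> v"
      proof (rule complex_eqI)
        show "Re (CLINT \<omega>|M. indicator A (X \<omega>) *\<^sub>R iexp (v * Z \<omega>))
          = Re (expectation (\<lambda>\<omega>. indicator A (X \<omega>)) *\<^sub>R char \<nu> v)"
          unfolding integral_Re[OF i, symmetric] using c by (simp add: Re_exp EA mult.commute)
        show "Im (CLINT \<omega>|M. indicator A (X \<omega>) *\<^sub>R iexp (v * Z \<omega>))
          = Im (expectation (\<lambda>\<omega>. indicator A (X \<omega>)) *\<^sub>R char \<nu> v)"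
          unfolding integral_Im[OF i, symmetric] using s by (simp add: Im_exp EA mult.commute)
      qed
    qed (use iA in auto)
    then show ?thesis by (simp add: EA)
  qed
  have "\<mu> \<Otimes>\<^sub>M \<nu> = distr M (borel \<Otimes>\<^sub>M borel) (\<lambda>\<omega>. (X \<omega>, Z \<omega>))"
  proof (rule pair_measure_eqI)
    show "sets (\<mu> \<Otimes>\<^sub>M \<nu>) = sets (distr M (borel \<Otimes>\<^sub>M borel) (\<lambda>\<omega>. (X \<omega>, Z \<omega>)))"
      by (simp cong: sets_pair_measure_cong)
    fix A B assume "A \<in> sets \<mu>" "B \<in> sets \<nu>"
    then have [measurable]: "A \<in> sets borel" "B \<in> sets borel" by auto
    have "emeasure (distr M (borel \<Otimes>\<^sub>M borel) (\<lambda>\<omega>. (X \<omega>, Z \<omega>))) (A \<times> B)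
        = emeasure M {\<omega> \<in> space M. X \<omega> \<in> A \<and> Z \<omega> \<in> B}"
      by (subst emeasure_distr) (auto intro!: arg_cong[where f = "emeasure M"])
    also have "\<dots> = ennreal (expectation (indicator {\<omega> \<in> space M. X \<omega> \<in> A \<and> Z \<omega> \<in> B} :: _ \<Rightarrow> real))"
      by (simp add: emeasure_eq_measure)
    also have "expectation (indicator {\<omega> \<in> space M. X \<omega> \<in> A \<and> Z \<omega> \<in> B} :: _ \<Rightarrow> real)
        = expectation (\<lambda>\<omega>. indicator A (X \<omega>) * indicator B (Z \<omega>))"
      by (intro Bochner_Integration.integral_cong) (auto split: split_indicator)
    finally show "emeasure \<mu> A * emeasure \<nu> B
        = emeasure (distr M (borel \<Otimes>\<^sub>M borel) (\<lambda>\<omega>. (X \<omega>, Z \<omega>))) (A \<times> B)"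
      by (simp add: prod \<mu>.emeasure_eq_measure \<nu>.emeasure_eq_measure ennreal_mult)
  qed (unfold_locales)
  then show ?thesis by simp
qed

section \<open>Gaussian tails\<close>

interpretation std_normal: real_distribution std_normal_distribution
  by (rule real_dist_normal_dist)

section \<open>Bounds, limits and derivative of the Gaussian distribution function\<close>

lemma Phi_bounds: "0 \<le> Phi x" "Phi x \<le> 1"
  by (simp_all add: Phi_def std_normal.cdf_nonneg std_normal.cdf_bounded_prob)

lemma Phi_at_top: "(Phi \<longlongrightarrow> 1) at_top" and Phi_at_bot: "(Phi \<longlongrightarrow> 0) at_bot"
  unfolding Phi_def by (rule std_normal.cdf_lim_at_top_prob std_normal.cdf_lim_at_bot)+

text \<open>On a window around \<open>x\<close> the function is a constant plus the integral of a
  continuous density, so the fundamental theorem of calculus applies. The base point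
  \<open>x - 1\<close> only serves to make \<open>x\<close> interior to the window.\<close>

lemma Phi_has_derivative: "(Phi has_real_derivative std_normal_density x) (at x)"
proof -
  have cont: "continuous_on A std_normal_density" for A
    unfolding normal_density_def by (intro continuous_intros) auto
  have Phi_eq: "Phi z = Phi (x - 1) + integral {x - 1..z} std_normal_density" if "z \<in> {x - 1<..<x + 1}" for z
  proof -
    have "Phi z - Phi (x - 1) = measure std_normal_distribution {x - 1<..z}"
      unfolding Phi_def using that by (intro std_normal.cdf_diff_eq) simp
    also have "\<dots> = (LINT p|std_normal_distribution. indicator {x - 1<..z} p)"
      by simp
    also have "\<dots> = (LINT p|lborel. std_normal_density p *\<^sub>R indicator {x - 1<..z} p)"
      by (subst integral_density) auto
    also have "\<dots> = (LINT p:{x - 1..z}|lborel. std_normal_density p)"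
      unfolding set_lebesgue_integral_def using AE_lborel_singleton[of "x - 1"]
      by (intro integral_cong_AE) (auto elim!: eventually_mono split: split_indicator)
    also have "\<dots> = integral {x - 1..z} std_normal_density"
      by (intro set_borel_integral_eq_integral borel_integrable_atLeastAtMost')
         (rule cont)
    finally show ?thesis by simp
  qed
  have "((\<lambda>z. Phi (x - 1) + integral {x - 1..z} std_normal_density) has_real_derivative std_normal_density x) (at x within {x - 1..x + 1})"
    using DERIV_add[OF DERIV_const integral_has_real_derivative[OF cont]] by simp
  then have "((\<lambda>z. Phi (x - 1) + integral {x - 1..z} std_normal_density) has_real_derivative std_normal_density x) (at x)"
    by (simp add: at_within_Icc_at)
  then show ?thesis
    by (rule has_field_derivative_transform_within_open[where S = "{x - 1<..<x + 1}"]) (use Phi_eq in auto)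
qed

lemma isCont_Phi: "isCont Phi x"
  using Phi_has_derivative by (rule DERIV_isCont)

lemma Phi_borel [measurable]: "Phi \<in> borel_measurable borel"
  by (intro borel_measurable_continuous_onI continuous_at_imp_continuous_on) (auto simp: isCont_Phi)

text \<open>A positive derivative makes \<open>Phi\<close> strictly increasing, so it cannot attain
  its upper bound. Strictness is what later drives the quantiles \<open>b n\<close> to
  infinity.\<close>

lemma Phi_less_1: "Phi x < 1"
proof -
  have "Phi x < Phi (x + 1)"
    by (rule DERIV_pos_imp_increasing) (auto intro!: exI Phi_has_derivative normal_density_pos)
  then show ?thesis using Phi_bounds(2)[of "x + 1"] by simp
qed

section \<open>Gaussian tail integrals and their exponential limits\<close>

lemma normal_tail_integral:
  "1 - Phi u = (LINT p|lborel. indicator {u<..} p * std_normal_density p)"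
proof -
  have "1 - Phi u = measure std_normal_distribution (UNIV - {..u})"
    using std_normal.prob_compl[of "{..u}"] by (simp add: Phi_def cdf_def)
  also have "UNIV - {..u} = {u<..}" by auto
  also have "measure std_normal_distribution {u<..} = (LINT p|std_normal_distribution. indicator {u<..} p)"
    by simp
  also have "\<dots> = (LINT p|lborel. std_normal_density p *\<^sub>R indicator {u<..} p)"
    by (subst integral_density) auto
  finally show ?thesis by (simp add: mult.commute)
qed

text \<open>Substitution p = b + z / b. Since (b + z / b)^2 / 2 = b^2 / 2 + z + z^2 / (2 b^2), the
  density splits off the factor \<open>std_normal_density b\<close>. The prefactor does not depend
  on \<open>g\<close> or \<open>u\<close> and will cancel in a quotient of two such
  integrals.\<close>

lemma scaled_tail_integral:
  fixes g :: "real \<Rightarrow> real"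
  assumes b: "b > 0"
  shows "(LINT p|lborel. indicator {u<..} p * (std_normal_density p * g p))
    = std_normal_density b / b *
      (LINT z|lborel. indicator {b * (u - b)<..} z * (exp (- z - z\<^sup>2 / (2 * b\<^sup>2)) * g (b + z / b)))"
proof -
  have dens: "std_normal_density (b + z / b) = std_normal_density b * exp (- z - z\<^sup>2 / (2 * b\<^sup>2))" for z
  proof -
    have "- (b + z / b)\<^sup>2 / 2 = - b\<^sup>2 / 2 + (- z - z\<^sup>2 / (2 * b\<^sup>2))"
      using b by (simp add: power2_eq_square field_simps)
    then show ?thesis by (simp add: std_normal_density_def exp_add[symmetric])
  qed
  have "(LINT p|lborel. indicator {u<..} p * (std_normal_density p * g p))
      = \<bar>1 / b\<bar> *\<^sub>R (LINT z|lborel. indicator {u<..} (b + 1 / b * z) *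
          (std_normal_density (b + 1 / b * z) * g (b + 1 / b * z)))"
    using b by (intro lborel_integral_real_affine) simp
  also have "\<dots> = (1 / b) * (LINT z|lborel. std_normal_density b * (indicator {b * (u - b)<..} z *
      (exp (- z - z\<^sup>2 / (2 * b\<^sup>2)) * g (b + z / b))))"
  proof -
    have "indicator {u<..} (b + 1 / b * z) = (indicator {b * (u - b)<..} z :: real)" for z
      using b by (auto simp: indicator_def field_simps)
    then show ?thesis
      using b dens by (auto intro!: Bochner_Integration.integral_cong simp: mult_ac)
  qed
  finally show ?thesis by simp
qed

lemma exp_tail_has_bochner_integral:
  "has_bochner_integral lborel (\<lambda>z::real. indicator {x<..} z * exp (- z)) (exp (- x))"
proof (rule has_bochner_integral_nn_integral)
  have "((\<lambda>z::real. - exp (- z)) \<longlongrightarrow> 0) at_top" by real_asymp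
  then have "(\<integral>\<^sup>+z. ennreal (exp (- z)) * indicator {x..} z \<partial>lborel) = 0 - (- exp (- x))"
    by (intro nn_integral_FTC_atLeast) (auto intro!: derivative_eq_intros)
  also have "(\<integral>\<^sup>+z. ennreal (exp (- z)) * indicator {x..} z \<partial>lborel)
      = (\<integral>\<^sup>+z. ennreal (indicator {x<..} z * exp (- z)) \<partial>lborel)"
    using AE_lborel_singleton[of x]
    by (intro nn_integral_cong_AE) (auto elim!: eventually_mono split: split_indicator)
  finally show "(\<integral>\<^sup>+z. ennreal (indicator {x<..} z * exp (- z)) \<partial>lborel) = ennreal (exp (- x))"
    by simp
qed auto

text \<open>Dominated convergence: the lower limits eventually exceed \<open>x - 1\<close>, and the
  Gaussian correction only decreases the integrand, so exp(-z) on the half-line above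
  \<open>x - 1\<close> dominates.\<close>

lemma tail_integral_tendsto:
  fixes g :: "nat \<Rightarrow> real \<Rightarrow> real"
  assumes b: "filterlim b at_top sequentially"
    and xs: "xs \<longlonglongrightarrow> x"
    and g[measurable]: "\<And>n. g n \<in> borel_measurable borel" "h \<in> borel_measurable borel"
    and bound: "\<And>n z. \<bar>g n z\<bar> \<le> 1"
    and lim: "\<And>z. (\<lambda>n. g n z) \<longlonglongrightarrow> h z"
  shows "(\<lambda>n. LINT z|lborel. indicator {xs n<..} z * (exp (- z - z\<^sup>2 / (2 * (b n)\<^sup>2)) * g n z))
    \<longlonglongrightarrow> (LINT z|lborel. indicator {x<..} z * (exp (- z) * h z))"
proof -
  have "eventually (\<lambda>n. xs n > x - 1) sequentially"
    using xs by (rule order_tendstoD) simp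
  then obtain n0 where n0: "\<And>n. n \<ge> n0 \<Longrightarrow> xs n > x - 1"
    unfolding eventually_sequentially by auto
  \<comment> \<open>The sequence is shifted by \<open>n0\<close> so that the domination holds at
    every index; the shift is undone at the end.\<close>
  have "(\<lambda>n. LINT z|lborel. indicator {xs (n + n0)<..} z * (exp (- z - z\<^sup>2 / (2 * (b (n + n0))\<^sup>2)) * g (n + n0) z))
    \<longlonglongrightarrow> (LINT z|lborel. indicator {x<..} z * (exp (- z) * h z))"
  proof (rule integral_dominated_convergence)
    show "integrable lborel (\<lambda>z::real. indicator {x - 1<..} z * exp (- z))"
      by (rule integrable.intros[OF exp_tail_has_bochner_integral])
    show "AE z in lborel. norm (indicator {xs (n + n0)<..} z * (exp (- z - z\<^sup>2 / (2 * (b (n + n0))\<^sup>2)) * g (n + n0) z))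
        \<le> indicator {x - 1<..} z * exp (- z)" for n
    proof (rule AE_I2)
      fix z :: real
      have "exp (- z - z\<^sup>2 / (2 * (b (n + n0))\<^sup>2)) * \<bar>g (n + n0) z\<bar> \<le> exp (- z) * 1"
        by (intro mult_mono bound) auto
      then show "norm (indicator {xs (n + n0)<..} z * (exp (- z - z\<^sup>2 / (2 * (b (n + n0))\<^sup>2)) * g (n + n0) z))
        \<le> indicator {x - 1<..} z * exp (- z)"
        using n0[of "n + n0"] by (auto simp: abs_mult split: split_indicator)
    qed
    \<comment> \<open>Indicators of half-lines with converging endpoints converge everywhere except
      possibly at the limiting endpoint, a null set.\<close>
    have "AE z in lborel. z \<noteq> x" by (rule AE_lborel_singleton)
    then show "AE z in lborel. (\<lambda>n. indicator {xs (n + n0)<..} z * (exp (- z - z\<^sup>2 / (2 * (b (n + n0))\<^sup>2)) * g (n + n0) z))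
        \<longlonglongrightarrow> indicator {x<..} z * (exp (- z) * h z)"
    proof eventually_elim
      fix z assume z: "z \<noteq> x"
      have "eventually (\<lambda>n. (indicator {xs n<..} z :: real) = indicator {x<..} z) sequentially"
      proof (cases "x < z")
        case True
        with xs have "eventually (\<lambda>n. xs n < z) sequentially" by (rule order_tendstoD)
        then show ?thesis by eventually_elim (use True in \<open>auto simp: indicator_def\<close>)
      next
        case False
        with z have "z < x" by simp
        with xs have "eventually (\<lambda>n. z < xs n) sequentially" by (rule order_tendstoD)
        then show ?thesis by eventually_elim (use False in \<open>auto simp: indicator_def\<close>)
      qed
      then have i: "(\<lambda>n. indicator {xs n<..} z :: real) \<longlonglongrightarrow> indicator {x<..} z"
        by (rule tendsto_eventually)
      have "((\<lambda>b. exp (- z - z\<^sup>2 / (2 * b\<^sup>2))) \<longlongrightarrow> exp (- z)) at_top" by real_asymp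
      then have e: "(\<lambda>n. exp (- z - z\<^sup>2 / (2 * (b n)\<^sup>2))) \<longlonglongrightarrow> exp (- z)"
        using b by (rule filterlim_compose)
      show "(\<lambda>n. indicator {xs (n + n0)<..} z * (exp (- z - z\<^sup>2 / (2 * (b (n + n0))\<^sup>2)) * g (n + n0) z))
        \<longlonglongrightarrow> indicator {x<..} z * (exp (- z) * h z)"
        by (rule LIMSEQ_ignore_initial_segment[OF tendsto_mult[OF i tendsto_mult[OF e lim]]])
    qed
  qed auto
  then show ?thesis by (rule LIMSEQ_offset)
qed

text \<open>The integrand has the explicit antiderivative \<open>F\<close> below: differentiating
  its two terms produces two density contributions that cancel. The value is the limit
  \<open>- exp (- y)\<close> at infinity minus \<open>F x\<close>.\<close>

lemma husler_reiss_tail_integral: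
  assumes l: "l > 0"
  shows "(LINT z|lborel. indicator {x<..} z * (exp (- z) * Phi (l + (y - z) / (2 * l))))
    = Phi (l + (x - y) / (2 * l)) * exp (- y) + Phi (l + (y - x) / (2 * l)) * exp (- x) - exp (- y)"
    (is "?L = ?R")
proof -
  define F where "F z = - Phi (l + (y - z) / (2 * l)) * exp (- z) - Phi (l + (z - y) / (2 * l)) * exp (- y)" for z
  \<comment> \<open>With a = (y - z) / (2 l) the squares of l + a and l - a differ by 4 l a = 2 (y -
    z), which is exactly compensated by the exponential factors.\<close>
  have sym: "std_normal_density (l + (y - z) / (2 * l)) * exp (- z)
      = std_normal_density (l + (z - y) / (2 * l)) * exp (- y)" for z
  proof -
    have "- (l + (y - z) / (2 * l))\<^sup>2 / 2 + (- z) = - (l + (z - y) / (2 * l))\<^sup>2 / 2 + (- y)"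
      using l by (simp add: power2_eq_square field_simps)
    then show ?thesis by (simp add: std_normal_density_def exp_add[symmetric])
  qed
  have deriv: "DERIV F z :> exp (- z) * Phi (l + (y - z) / (2 * l))" for z
  proof -
    have 1: "((\<lambda>z. Phi (l + (y - z) / (2 * l))) has_real_derivative
        std_normal_density (l + (y - z) / (2 * l)) * (- 1 / (2 * l))) (at z)"
      using l by (intro DERIV_chain2[OF Phi_has_derivative]) (auto intro!: derivative_eq_intros)
    have 2: "((\<lambda>z. Phi (l + (z - y) / (2 * l))) has_real_derivative
        std_normal_density (l + (z - y) / (2 * l)) * (1 / (2 * l))) (at z)"
      using l by (intro DERIV_chain2[OF Phi_has_derivative]) (auto intro!: derivative_eq_intros)
    have 3: "((\<lambda>z::real. exp (- z)) has_real_derivative - exp (- z)) (at z)"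
      by (auto intro!: derivative_eq_intros)
    have 4: "std_normal_density (l + (y - z) / (2 * l)) * exp (- z) / (2 * l)
      = std_normal_density (l + (z - y) / (2 * l)) * exp (- y) / (2 * l)"
      by (simp only: sym)
    show ?thesis
      unfolding F_def
      by (rule DERIV_cong[OF DERIV_diff[OF DERIV_mult[OF DERIV_minus[OF 1] 3] DERIV_cmult_right[OF 2]]])
         (use 4 in \<open>simp add: mult_ac\<close>)
  qed
  have "filterlim (\<lambda>z. l + (z - y) / (2 * l)) at_top at_top"
    using l by real_asymp
  then have P: "((\<lambda>z. Phi (l + (z - y) / (2 * l))) \<longlongrightarrow> 1) at_top"
    by (rule filterlim_compose[OF Phi_at_top])
  have "((\<lambda>z::real. exp (- z)) \<longlongrightarrow> 0) at_top" by real_asymp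
  then have "((\<lambda>z. Phi (l + (y - z) / (2 * l)) * exp (- z)) \<longlongrightarrow> 0) at_top"
    by (rule Lim_null_comparison[rotated])
       (auto intro!: always_eventually mult_left_le_one_le simp: abs_mult Phi_bounds)
  from tendsto_diff[OF tendsto_minus[OF this] tendsto_mult[OF P tendsto_const[of "exp (- y)"]]]
  have "(F \<longlongrightarrow> - exp (- y)) at_top"
    by (simp add: F_def[abs_def])
  then have "(\<integral>\<^sup>+z. ennreal (exp (- z) * Phi (l + (y - z) / (2 * l))) * indicator {x..} z \<partial>lborel)
      = ennreal (- exp (- y) - F x)"
    by (intro nn_integral_FTC_atLeast deriv) (auto simp: Phi_bounds)
  also have "- exp (- y) - F x = ?R" by (simp add: F_def)
  finally have nn: "(\<integral>\<^sup>+z. ennreal (indicator {x..} z * (exp (- z) * Phi (l + (y - z) / (2 * l)))) \<partial>lborel) = ennreal ?R"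
    by (simp add: ennreal_mult' ennreal_indicator mult.commute Phi_bounds)
  \<comment> \<open>The integral was computed in the extended nonnegative reals. Reading it as a
    real number requires a nonnegative value, which follows because \<open>F\<close> increases to
    its limit.\<close>
  have "F x \<le> - exp (- y)"
    using \<open>(F \<longlongrightarrow> - exp (- y)) at_top\<close>
  proof (rule tendsto_lowerbound)
    show "\<forall>\<^sub>F z in at_top. F x \<le> F z"
      using eventually_ge_at_top[of x]
    proof eventually_elim
      fix z assume "x \<le> z"
      then show "F x \<le> F z"
        by (rule DERIV_nonneg_imp_nondecreasing) (intro exI conjI, rule deriv, simp add: Phi_bounds)
    qed
  qed simp
  then have "?R \<ge> 0" by (simp add: F_def)
  have "?L = (LINT z|lborel. indicator {x..} z * (exp (- z) * Phi (l + (y - z) / (2 * l))))"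
    using AE_lborel_singleton[of x]
    by (intro integral_cong_AE) (auto elim!: eventually_mono split: split_indicator)
  also have "\<dots> = ?R"
    by (rule has_bochner_integral_integral_eq, rule has_bochner_integral_nn_integral)
       (use nn \<open>?R \<ge> 0\<close> in \<open>auto simp: Phi_bounds\<close>)
  finally show ?thesis .
qed

section \<open>Gaussian pairs\<close>

text \<open>A point mass of mean 0 makes \<open>W\<close> vanish almost surely, and both sides equal
  1. Otherwise \<open>W\<close> is rescaled to a standard normal variable, whose characteristic
  function is evaluated at the standard deviation.\<close>

lemma (in prob_space) gaussian_var_char:
  assumes "gaussian_var M W" and mean: "expectation W = 0"
  shows "(CLINT \<omega>|M. iexp (W \<omega>)) = exp (- variance W / 2)"
proof -
  obtain \<mu> \<sigma> where W[measurable]: "W \<in> borel_measurable M" and \<sigma>: "0 \<le> \<sigma>"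
    and law: "distr M borel W = normal_law \<mu> \<sigma>"
    using assms by (auto simp: gaussian_var_def)
  show ?thesis
  proof (cases "\<sigma> = 0")
    case True
    have "AE p in distr M borel W. p = \<mu>"
      unfolding law normal_law_def using True by (simp add: AE_return)
    then have AE: "AE \<omega> in M. W \<omega> = \<mu>"
      by (simp add: AE_distr_iff)
    then have "expectation W = expectation (\<lambda>_. \<mu>)"
      by (intro integral_cong_AE) auto
    with mean have "\<mu> = 0" by (simp add: prob_space)
    with AE have AE: "AE \<omega> in M. W \<omega> = 0" by simp
    have "(CLINT \<omega>|M. iexp (W \<omega>)) = (CLINT \<omega>|M. 1)"
      using AE by (intro integral_cong_AE) auto
    moreover have "expectation (\<lambda>\<omega>. (W \<omega>)\<^sup>2) = expectation (\<lambda>_. 0)"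
      using AE by (intro integral_cong_AE) auto
    ultimately show ?thesis by (simp add: mean prob_space)
  next
    case False
    with \<sigma> have \<sigma>: "\<sigma> > 0" by simp
    have D: "distributed M lborel W (normal_density \<mu> \<sigma>)"
      using law False by (auto simp: distributed_def normal_law_def cong: distr_cong)
    have "\<mu> = 0" using normal_distributed_expectation[OF \<sigma> D] mean by simp
    then have "distributed M lborel (\<lambda>\<omega>. W \<omega> / \<sigma>) std_normal_density"
      using D normal_standard_normal_convert[OF \<sigma>, of W \<mu>] by simp
    then have S: "distr M borel (\<lambda>\<omega>. W \<omega> / \<sigma>) = std_normal_distribution"
      by (auto simp: distributed_def cong: distr_cong)
    have "(CLINT \<omega>|M. iexp (W \<omega>)) = char (distr M borel (\<lambda>\<omega>. W \<omega> / \<sigma>)) \<sigma>"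
      unfolding char_def using \<sigma> by (subst integral_distr) auto
    also have "\<dots> = exp (- \<sigma>\<^sup>2 / 2)"
      by (simp add: S char_std_normal_distribution)
    also have "\<sigma>\<^sup>2 = variance W"
      using normal_distributed_variance[OF \<sigma> D] by simp
    finally show ?thesis by simp
  qed
qed

lemma (in prob_space) gaussian_pair_measurable:
  assumes "gaussian_pair M X Y"
  shows "X \<in> borel_measurable M" "Y \<in> borel_measurable M"
proof -
  have "gaussian_var M (\<lambda>\<omega>. u * X \<omega> + v * Y \<omega>)" for u v
    using assms by (simp add: gaussian_pair_def)
  from this[of 1 0] this[of 0 1] show "X \<in> borel_measurable M" "Y \<in> borel_measurable M"
    by (simp_all add: gaussian_var_def)
qed

text \<open>By the definition of a Gaussian pair the exponent is a one-dimensional Gaussian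
  variable, so only its variance has to be computed, and this is a quadratic form in the
  coefficients.\<close>

lemma (in prob_space) gaussian_pair_char:
  assumes "gaussian_pair M X Y"
    and "expectation X = 0" "expectation Y = 0" "variance X = 1" "variance Y = 1"
    and "covariance M X Y = r"
  shows "(CLINT \<omega>|M. iexp (u * X \<omega> + v * Y \<omega>)) = exp (- (u\<^sup>2 + 2 * r * u * v + v\<^sup>2) / 2)"
proof -
  have G: "gaussian_var M (\<lambda>\<omega>. u * X \<omega> + v * Y \<omega>)" for u v
    using assms(1) by (simp add: gaussian_pair_def)
  note [measurable] = gaussian_pair_measurable[OF assms(1)]
  have E2: "expectation (\<lambda>\<omega>. (X \<omega>)\<^sup>2) = 1" "expectation (\<lambda>\<omega>. (Y \<omega>)\<^sup>2) = 1" "expectation (\<lambda>\<omega>. X \<omega> * Y \<omega>) = r"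
    using assms by (simp_all add: covariance_def)
  \<comment> \<open>The integral of a non-integrable function is 0 by convention, so a second moment
    equal to 1 certifies integrability.\<close>
  have I2: "integrable M (\<lambda>\<omega>. (X \<omega>)\<^sup>2)" "integrable M (\<lambda>\<omega>. (Y \<omega>)\<^sup>2)"
    using E2 not_integrable_integral_eq by fastforce+
  have I: "integrable M X" "integrable M Y"
    using I2 by (auto intro: square_integrable_imp_integrable)
  have "2 * \<bar>X \<omega> * Y \<omega>\<bar> \<le> (X \<omega>)\<^sup>2 + (Y \<omega>)\<^sup>2" for \<omega>
    using sum_squares_bound[of "\<bar>X \<omega>\<bar>" "\<bar>Y \<omega>\<bar>"] by (simp add: abs_mult)
  then have "\<bar>X \<omega> * Y \<omega>\<bar> \<le> (X \<omega>)\<^sup>2 + (Y \<omega>)\<^sup>2" for \<omega>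
    by (smt (verit, best))
  then have IXY: "integrable M (\<lambda>\<omega>. X \<omega> * Y \<omega>)"
    by (intro Bochner_Integration.integrable_bound[OF Bochner_Integration.integrable_add[OF I2]])
       (auto intro!: AE_I2)
  let ?W = "\<lambda>\<omega>. u * X \<omega> + v * Y \<omega>"
  have mean: "expectation ?W = 0"
    using I assms by simp
  have "variance ?W = expectation (\<lambda>\<omega>. u\<^sup>2 * (X \<omega>)\<^sup>2 + 2 * u * v * (X \<omega> * Y \<omega>) + v\<^sup>2 * (Y \<omega>)\<^sup>2)"
    unfolding mean by (intro Bochner_Integration.integral_cong) (auto simp: power2_eq_square algebra_simps)
  also have "\<dots> = u\<^sup>2 + 2 * r * u * v + v\<^sup>2"
    using I2 IXY by (simp add: E2)
  finally show ?thesis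
    using gaussian_var_char[OF G mean] by simp
qed

lemma (in prob_space) gaussian_pair_marginals:
  assumes "gaussian_pair M X Y"
    and "expectation X = 0" "expectation Y = 0" "variance X = 1" "variance Y = 1"
  shows "distr M borel X = std_normal_distribution" "distr M borel Y = std_normal_distribution"
proof -
  note [measurable] = gaussian_pair_measurable[OF assms(1)]
  \<comment> \<open>The correlation may be arbitrary here: its term vanishes once one coefficient is
    0.\<close>
  note char = gaussian_pair_char[OF assms refl]
  have "char (distr M borel X) = char std_normal_distribution"
  proof
    fix u
    have "char (distr M borel X) u = (CLINT \<omega>|M. iexp (u * X \<omega>))"
      unfolding char_def by (subst integral_distr) auto
    then show "char (distr M borel X) u = char std_normal_distribution u"
      using char[of u 0] by (simp add: char_std_normal_distribution)
  qed
  then show "distr M borel X = std_normal_distribution"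
    by (intro Levy_uniqueness real_distribution_distr real_dist_normal_dist) auto
  have "char (distr M borel Y) = char std_normal_distribution"
  proof
    fix u
    have "char (distr M borel Y) u = (CLINT \<omega>|M. iexp (u * Y \<omega>))"
      unfolding char_def by (subst integral_distr) auto
    then show "char (distr M borel Y) u = char std_normal_distribution u"
      using char[of 0 u] by (simp add: char_std_normal_distribution)
  qed
  then show "distr M borel Y = std_normal_distribution"
    by (intro Levy_uniqueness real_distribution_distr real_dist_normal_dist) auto
qed

text \<open>Regressing \<open>Y\<close> on \<open>X\<close> leaves a standardised residual that is
  standard normal and independent of \<open>X\<close>. Given X = p, the event Y <= v bounds the
  residual by (v - r p) / sqrt(1 - r^2); Fubini then integrates over p. The strict bound on
  \<open>r\<close> keeps the divisor positive.\<close>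

lemma (in prob_space) gaussian_pair_prob:
  assumes G: "gaussian_pair M X Y"
    and moments: "expectation X = 0" "expectation Y = 0" "variance X = 1" "variance Y = 1"
    and cov: "covariance M X Y = r" and r: "\<bar>r\<bar> < 1"
  shows "prob {\<omega> \<in> space M. u < X \<omega> \<and> Y \<omega> \<le> v}
    = (LINT p|lborel. indicator {u<..} p * (std_normal_density p * Phi ((v - r * p) / sqrt (1 - r\<^sup>2))))"
proof -
  define s where "s = sqrt (1 - r\<^sup>2)"
  have s2: "s\<^sup>2 = 1 - r\<^sup>2" and s: "s > 0"
    using r by (auto simp: s_def abs_square_less_1 intro: less_imp_le)
  note [measurable] = gaussian_pair_measurable[OF G]
  define Z where "Z \<omega> = (Y \<omega> - r * X \<omega>) / s" for \<omega>
  have [measurable]: "Z \<in> borel_measurable M" unfolding Z_def[abs_def] by measurable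
  have YZ: "Y \<omega> = r * X \<omega> + s * Z \<omega>" for \<omega>
    using s by (simp add: Z_def)
  let ?N = std_normal_distribution
  have law: "distr M (borel \<Otimes>\<^sub>M borel) (\<lambda>\<omega>. (X \<omega>, Z \<omega>)) = ?N \<Otimes>\<^sub>M ?N"
  proof (rule product_law_of_char)
    fix a c
    have "a * X \<omega> + c * Z \<omega> = (a - r * (c / s)) * X \<omega> + c / s * Y \<omega>" for \<omega>
      using s by (simp add: Z_def field_simps)
    then have "(CLINT \<omega>|M. iexp (a * X \<omega> + c * Z \<omega>))
        = exp (- ((a - r * (c / s))\<^sup>2 + 2 * r * (a - r * (c / s)) * (c / s) + (c / s)\<^sup>2) / 2)"
      by (simp only: gaussian_pair_char[OF G moments cov])
    \<comment> \<open>The cross terms cancel, so the joint characteristic function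
      factorises.\<close>
    also have "(a - r * (c / s))\<^sup>2 + 2 * r * (a - r * (c / s)) * (c / s) + (c / s)\<^sup>2 = a\<^sup>2 + (c / s)\<^sup>2 * s\<^sup>2"
      unfolding s2 by algebra
    also have "(c / s)\<^sup>2 * s\<^sup>2 = c\<^sup>2"
      using s by (simp add: power_divide)
    also have "exp (- (a\<^sup>2 + c\<^sup>2) / 2) = exp (- a\<^sup>2 / 2) * exp (- c\<^sup>2 / 2)"
      by (simp add: mult_exp_exp add_divide_distrib)
    finally show "(CLINT \<omega>|M. iexp (a * X \<omega> + c * Z \<omega>)) = char ?N a * char ?N c"
      by (simp add: char_std_normal_distribution del: of_real_add)
  qed (simp_all add: real_dist_normal_dist)
  \<comment> \<open>The event in the coordinates of \<open>X\<close> and the residual; its section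
    at p is a half-line when u < p and empty otherwise.\<close>
  define S where "S = {(p, q). u < p \<and> r * p + s * q \<le> v}"
  have "{z \<in> space (borel \<Otimes>\<^sub>M borel). u < fst z \<and> r * fst z + s * snd z \<le> v} \<in> sets (borel \<Otimes>\<^sub>M borel)"
    by measurable
  moreover have "{z \<in> space (borel \<Otimes>\<^sub>M borel). u < fst z \<and> r * fst z + s * snd z \<le> v} = S"
    by (auto simp: S_def space_pair_measure)
  ultimately have S[measurable]: "S \<in> sets (borel \<Otimes>\<^sub>M borel)"
    by (simp only:)
  have slice: "emeasure ?N (Pair p -` S) = ennreal (indicator {u<..} p * Phi ((v - r * p) / s))" for p
  proof -
    have "Pair p -` S = (if u < p then {..(v - r * p) / s} else {})"
      using s by (auto simp: S_def field_simps)
    then show ?thesis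
      by (simp add: std_normal.emeasure_eq_measure Phi_def cdf_def)
  qed
  have "emeasure M {\<omega> \<in> space M. u < X \<omega> \<and> Y \<omega> \<le> v}
      = emeasure (distr M (borel \<Otimes>\<^sub>M borel) (\<lambda>\<omega>. (X \<omega>, Z \<omega>))) S"
  proof -
    have "(\<lambda>\<omega>. (X \<omega>, Z \<omega>)) -` S \<inter> space M = {\<omega> \<in> space M. u < X \<omega> \<and> Y \<omega> \<le> v}"
      by (auto simp: S_def YZ)
    then show ?thesis by (subst emeasure_distr) simp_all
  qed
  also have "\<dots> = (\<integral>\<^sup>+p. ennreal (indicator {u<..} p * Phi ((v - r * p) / s)) \<partial>?N)"
    unfolding law slice[symmetric]
    by (intro std_normal.emeasure_pair_measure_alt) (use S in \<open>simp cong: sets_pair_measure_cong\<close>)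
  also have "\<dots> = ennreal (LINT p|?N. indicator {u<..} p * Phi ((v - r * p) / s))"
    by (intro nn_integral_eq_integral std_normal.integrable_const_bound[of _ 1])
       (auto simp: Phi_bounds abs_mult intro!: AE_I2 mult_le_one split: split_indicator)
  finally have "prob {\<omega> \<in> space M. u < X \<omega> \<and> Y \<omega> \<le> v}
      = (LINT p|?N. indicator {u<..} p * Phi ((v - r * p) / s))"
    by (simp add: emeasure_eq_measure integral_nonneg_AE Phi_bounds)
  also have "\<dots> = (LINT p|lborel. std_normal_density p *\<^sub>R (indicator {u<..} p * Phi ((v - r * p) / s)))"
    by (subst integral_density) auto
  finally show ?thesis by (simp add: s_def mult_ac)
qed

section \<open>Limits at the quantile scale\<close>

text \<open>For fixed \<open>C\<close> the tail 1 - Phi(C) is positive and so eventually exceeds 1 /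
  n, the tail at \<open>b n\<close>; monotonicity of \<open>Phi\<close> gives the order. The
  quantile equation starts at n = 2, since for n = 1 it would force \<open>Phi\<close> to take the
  value 0.\<close>

lemma quantile_at_top:
  fixes b :: "nat \<Rightarrow> real"
  assumes b: "\<And>n. n \<ge> 2 \<Longrightarrow> 1 - Phi (b n) = 1 / real n"
  shows "filterlim b at_top sequentially"
  unfolding filterlim_at_top
proof
  fix C
  have "(\<lambda>n. 1 / real n) \<longlonglongrightarrow> 0" by real_asymp
  then have "eventually (\<lambda>n. 1 / real n < 1 - Phi C) sequentially"
    by (rule order_tendstoD) (simp add: Phi_less_1)
  then show "eventually (\<lambda>n. C \<le> b n) sequentially"
    using eventually_ge_at_top[of 2]
  proof eventually_elim
    fix n :: nat assume "1 / real n < 1 - Phi C" "2 \<le> n"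
    with b[of n] have "Phi C < Phi (b n)" by simp
    then show "C \<le> b n"
      using std_normal.cdf_nondecreasing[of "b n" C] by (force simp: Phi_def)
  qed
qed

text \<open>The quantile equation writes 1 / n as the same prefactor times a tail integral with g =
  1. Multiplying by n therefore turns the expression into a quotient of two rescaled integrals whose
  denominator tends to 1, without any expansion of \<open>b n\<close>.\<close>

lemma quantile_tail_tendsto:
  fixes b u :: "nat \<Rightarrow> real" and g :: "nat \<Rightarrow> real \<Rightarrow> real"
  assumes b: "\<And>n. n \<ge> 2 \<Longrightarrow> 1 - Phi (b n) = 1 / real n"
    and u: "(\<lambda>n. b n * (u n - b n)) \<longlonglongrightarrow> x"
    and g[measurable]: "\<And>n. g n \<in> borel_measurable borel" "h \<in> borel_measurable borel"
    and bound: "\<And>n p. \<bar>g n p\<bar> \<le> 1"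
    and lim: "\<And>z. (\<lambda>n. g n (b n + z / b n)) \<longlonglongrightarrow> h z"
  shows "(\<lambda>n. real n * (LINT p|lborel. indicator {u n<..} p * (std_normal_density p * g n p)))
    \<longlonglongrightarrow> (LINT z|lborel. indicator {x<..} z * (exp (- z) * h z))"
proof -
  have b_top: "filterlim b at_top sequentially" using b by (rule quantile_at_top)
  \<comment> \<open>The rescaled tail beyond \<open>b n\<close> itself, hence lower limit 0 and
    weight 1.\<close>
  define J where "J n = (LINT z|lborel. indicator {0<..} z * (exp (- z - z\<^sup>2 / (2 * (b n)\<^sup>2)) * 1))" for n
  define I where "I n = (LINT z|lborel. indicator {b n * (u n - b n)<..} z *
      (exp (- z - z\<^sup>2 / (2 * (b n)\<^sup>2)) * g n (b n + z / b n)))" for n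
  have "J \<longlonglongrightarrow> (LINT z|lborel. indicator {0<..} z * (exp (- z) * 1))"
    unfolding J_def by (rule tail_integral_tendsto[OF b_top]) auto
  also have "(LINT z|lborel. indicator {0<..} z * (exp (- z) * 1)) = (1::real)"
    using has_bochner_integral_integral_eq[OF exp_tail_has_bochner_integral[of 0]] by simp
  finally have J: "J \<longlonglongrightarrow> 1" .
  have I: "I \<longlonglongrightarrow> (LINT z|lborel. indicator {x<..} z * (exp (- z) * h z))"
    unfolding I_def by (rule tail_integral_tendsto[OF b_top u]) (auto simp: bound lim)
  have "eventually (\<lambda>n. b n > 0) sequentially"
    using b_top by (simp add: filterlim_at_top_dense)
  then have "eventually (\<lambda>n. I n / J n
      = real n * (LINT p|lborel. indicator {u n<..} p * (std_normal_density p * g n p))) sequentially"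
    using eventually_ge_at_top[of 2]
  proof eventually_elim
    fix n :: nat assume bn: "0 < b n" and n: "2 \<le> n"
    have "1 / real n = (LINT p|lborel. indicator {b n<..} p * (std_normal_density p * 1))"
      using b[OF n] normal_tail_integral[of "b n"] by simp
    also have "\<dots> = std_normal_density (b n) / b n * J n"
      unfolding J_def by (subst scaled_tail_integral[OF bn]) simp
    finally have e: "1 / real n = std_normal_density (b n) / b n * J n" .
    then have "J n \<noteq> 0" using n by auto
    with e n have "std_normal_density (b n) / b n = 1 / (real n * J n)"
      by (simp add: field_simps)
    then show "I n / J n = real n * (LINT p|lborel. indicator {u n<..} p * (std_normal_density p * g n p))"
      unfolding I_def using n by (subst scaled_tail_integral[OF bn]) simp
  qed
  moreover have "(\<lambda>n. I n / J n) \<longlonglongrightarrow> (LINT z|lborel. indicator {x<..} z * (exp (- z) * h z))"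
    using tendsto_divide[OF I J] by simp
  ultimately show ?thesis by (rule Lim_transform_eventually[rotated])
qed

text \<open>Comparison with (1 - a / n)^n: on the unit interval n-th powers differ by at most n
  times the difference of their bases, here |n p(n) - a|.\<close>

lemma power_tendsto_exp_minus:
  fixes p :: "nat \<Rightarrow> real"
  assumes p: "\<And>n. 0 \<le> p n" "\<And>n. p n \<le> 1" and lim: "(\<lambda>n. real n * p n) \<longlonglongrightarrow> a"
  shows "(\<lambda>n. (1 - p n) ^ n) \<longlonglongrightarrow> exp (- a)"
proof -
  have "0 \<le> a" using lim p(1) by (intro LIMSEQ_le_const[OF lim]) auto
  \<comment> \<open>From \<open>n0\<close> on, 1 - a / n lies in the unit interval, as the power
    estimate demands.\<close>
  obtain n0 :: nat where n0: "real n0 \<ge> a" "n0 > 0"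
    by (metis gt_ex less_eq_real_def linorder_not_le of_nat_0_less_iff order_less_le_trans reals_Archimedean2)
  have "eventually (\<lambda>n. norm ((1 - p n) ^ n - (1 - a / real n) ^ n) \<le> \<bar>real n * p n - a\<bar>) sequentially"
    using eventually_ge_at_top[of n0]
  proof eventually_elim
    fix n assume n: "n0 \<le> n"
    then have "0 < n" "a \<le> real n" using n0 by auto
    have "norm ((1 - p n) ^ n - (1 - a / real n) ^ n) \<le> real n * norm ((1 - p n) - (1 - a / real n))"
      using p[of n] \<open>0 \<le> a\<close> \<open>0 < n\<close> \<open>a \<le> real n\<close> by (intro norm_power_diff) (auto simp: field_simps)
    also have "\<dots> = \<bar>real n * ((1 - p n) - (1 - a / real n))\<bar>"
      by (simp only: abs_mult real_norm_def abs_of_nat)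
    also have "\<dots> = \<bar>real n * p n - a\<bar>"
      using \<open>0 < n\<close> by (subst abs_minus_commute) (simp add: algebra_simps)
    finally show "norm ((1 - p n) ^ n - (1 - a / real n) ^ n) \<le> \<bar>real n * p n - a\<bar>" .
  qed
  moreover have "(\<lambda>n. \<bar>real n * p n - a\<bar>) \<longlonglongrightarrow> 0"
    using lim by (simp add: LIM_zero_iff tendsto_rabs_zero_iff)
  ultimately have "(\<lambda>n. (1 - p n) ^ n - (1 - a / real n) ^ n) \<longlonglongrightarrow> 0"
    by (rule Lim_null_comparison)
  moreover have "(\<lambda>n. (1 - a / real n) ^ n) \<longlonglongrightarrow> exp (- a)"
    using tendsto_exp_limit_sequentially[of "- a"] by simp
  ultimately show ?thesis
    using tendsto_add by fastforce
qed

text \<open>Multiplying numerator and denominator by \<open>b n\<close> expresses both through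
  convergent quantities: the numerator tends to 2 l^2 + y - z and the denominator to 2 l.\<close>

lemma conditional_argument_tendsto:
  fixes b \<rho> v :: "nat \<Rightarrow> real"
  assumes b: "filterlim b at_top sequentially" and l: "l > 0"
    and \<rho>: "(\<lambda>n. (b n)\<^sup>2 * (1 - \<rho> n)) \<longlonglongrightarrow> 2 * l\<^sup>2" and \<rho>1: "\<rho> \<longlonglongrightarrow> 1"
    and v: "(\<lambda>n. b n * (v n - b n)) \<longlonglongrightarrow> y"
  shows "(\<lambda>n. (v n - \<rho> n * (b n + z / b n)) / sqrt (1 - (\<rho> n)\<^sup>2)) \<longlonglongrightarrow> l + (y - z) / (2 * l)"
proof -
  have "(\<lambda>n. ((b n)\<^sup>2 * (1 - \<rho> n) + b n * (v n - b n) - \<rho> n * z) / (sqrt ((b n)\<^sup>2 * (1 - \<rho> n)) * sqrt (1 + \<rho> n)))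
      \<longlonglongrightarrow> (2 * l\<^sup>2 + y - 1 * z) / (sqrt (2 * l\<^sup>2) * sqrt (1 + 1))"
    using l by (intro tendsto_intros \<rho> \<rho>1 v) auto
  also have "(2 * l\<^sup>2 + y - 1 * z) / (sqrt (2 * l\<^sup>2) * sqrt (1 + 1)) = l + (y - z) / (2 * l)"
    using l by (simp add: real_sqrt_mult power2_eq_square field_simps)
  finally have main: "(\<lambda>n. ((b n)\<^sup>2 * (1 - \<rho> n) + b n * (v n - b n) - \<rho> n * z) / (sqrt ((b n)\<^sup>2 * (1 - \<rho> n)) * sqrt (1 + \<rho> n)))
      \<longlonglongrightarrow> l + (y - z) / (2 * l)" .
  have "eventually (\<lambda>n. b n > 0) sequentially"
    using b by (simp add: filterlim_at_top_dense)
  then have "eventually (\<lambda>n. ((b n)\<^sup>2 * (1 - \<rho> n) + b n * (v n - b n) - \<rho> n * z) / (sqrt ((b n)\<^sup>2 * (1 - \<rho> n)) * sqrt (1 + \<rho> n))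
      = (v n - \<rho> n * (b n + z / b n)) / sqrt (1 - (\<rho> n)\<^sup>2)) sequentially"
  proof eventually_elim
    fix n assume bn: "0 < b n"
    have "sqrt ((b n)\<^sup>2 * (1 - \<rho> n)) * sqrt (1 + \<rho> n) = b n * sqrt (1 - (\<rho> n)\<^sup>2)"
    proof -
      have "(b n)\<^sup>2 * (1 - \<rho> n) * (1 + \<rho> n) = (b n)\<^sup>2 * (1 - (\<rho> n)\<^sup>2)"
        by (simp add: power2_eq_square algebra_simps)
      then have "sqrt ((b n)\<^sup>2 * (1 - \<rho> n)) * sqrt (1 + \<rho> n) = sqrt ((b n)\<^sup>2 * (1 - (\<rho> n)\<^sup>2))"
        by (simp only: real_sqrt_mult[symmetric])
      then show ?thesis using bn by (simp add: real_sqrt_mult)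
    qed
    moreover have "(b n)\<^sup>2 * (1 - \<rho> n) + b n * (v n - b n) - \<rho> n * z = b n * (v n - \<rho> n * (b n + z / b n))"
      using bn by (simp add: power2_eq_square field_simps)
    ultimately show "((b n)\<^sup>2 * (1 - \<rho> n) + b n * (v n - b n) - \<rho> n * z) / (sqrt ((b n)\<^sup>2 * (1 - \<rho> n)) * sqrt (1 + \<rho> n))
      = (v n - \<rho> n * (b n + z / b n)) / sqrt (1 - (\<rho> n)\<^sup>2)"
      using bn by simp
  qed
  with main show ?thesis by (rule Lim_transform_eventually)
qed

text \<open>The origin of the norming constants: the threshold is b (1 + t x / b^2)^(1 / t), which
  is b + x / b up to smaller terms.\<close>

lemma power_threshold_asymptotics:
  fixes t x :: real
  assumes "t > 0"
  shows "((\<lambda>b. b * ((t * b powr (t - 2) * x + b powr t) powr (1 / t) - b)) \<longlongrightarrow> x) at_top"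
    and "filterlim (\<lambda>b. (t * b powr (t - 2) * x + b powr t) powr (1 / t)) at_top at_top"
    and "eventually (\<lambda>b. t * b powr (t - 2) * x + b powr t > 0) at_top"
  using assms by real_asymp+

section \<open>Maxima of Gaussian arrays\<close>

lemma row_max_le_iff: "n \<ge> 1 \<Longrightarrow> row_max X n \<omega> \<le> u \<longleftrightarrow> (\<forall>i\<in>{1..n}. X n i \<omega> \<le> u)"
  by (simp add: row_max_def)

lemma row_max_ge: "n \<ge> 1 \<Longrightarrow> X n 1 \<omega> \<le> row_max X n \<omega>"
  unfolding row_max_def by (rule Max_ge) auto

lemma abs_powr_le_iff:
  fixes m r t :: real
  assumes "t > 0" "r > 0"
  shows "\<bar>m\<bar> powr t \<le> r \<longleftrightarrow> \<bar>m\<bar> \<le> r powr (1 / t)"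
proof
  assume "\<bar>m\<bar> powr t \<le> r"
  then have "(\<bar>m\<bar> powr t) powr (1 / t) \<le> r powr (1 / t)"
    using assms by (intro powr_mono2) auto
  then show "\<bar>m\<bar> \<le> r powr (1 / t)" using assms by (simp add: powr_powr)
next
  assume "\<bar>m\<bar> \<le> r powr (1 / t)"
  then have "\<bar>m\<bar> powr t \<le> (r powr (1 / t)) powr t"
    using assms by (intro powr_mono2) auto
  then show "\<bar>m\<bar> powr t \<le> r" using assms by (simp add: powr_powr)
qed

lemma (in prob_space) gaussian_array_pair:
  assumes "gaussian_array M X Y \<rho>" "i \<in> {1..n}"
  shows "gaussian_pair M (X n i) (Y n i)"
    "expectation (X n i) = 0" "expectation (Y n i) = 0"
    "variance (X n i) = 1" "variance (Y n i) = 1"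
    "covariance M (X n i) (Y n i) = \<rho> n"
proof -
  have "n \<ge> 1" using assms(2) by simp
  note row = assms(1)[unfolded gaussian_array_def, rule_format, OF this]
  show "gaussian_pair M (X n i) (Y n i)"
    "expectation (X n i) = 0" "expectation (Y n i) = 0"
    "variance (X n i) = 1" "variance (Y n i) = 1"
    "covariance M (X n i) (Y n i) = \<rho> n"
    using row assms(2) by blast+
qed

text \<open>$P(X > u \mbox{ or } Y > v)$ split as $P(Y > v) + P(X > u, Y \le v)$, for correlation $r$.\<close>

definition joint_exceedance :: "real \<Rightarrow> real \<Rightarrow> real \<Rightarrow> real" where
  "joint_exceedance r u v = (LINT p|lborel. indicator {v<..} p * std_normal_density p)
    + (LINT p|lborel. indicator {u<..} p * (std_normal_density p * Phi ((v - r * p) / sqrt (1 - r\<^sup>2))))"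

text \<open>The event Y <= v is split according to whether X <= u; its probability is one minus the
  first term of \<open>joint_exceedance\<close>, and the part with X > u is the second.\<close>

lemma (in prob_space) gaussian_pair_cdf:
  assumes G: "gaussian_pair M X Y"
    and moments: "expectation X = 0" "expectation Y = 0" "variance X = 1" "variance Y = 1"
    and cov: "covariance M X Y = r" and r: "\<bar>r\<bar> < 1"
  shows "prob {\<omega> \<in> space M. X \<omega> \<le> u \<and> Y \<omega> \<le> v} = 1 - joint_exceedance r u v"
proof -
  note [measurable] = gaussian_pair_measurable[OF G]
  have "prob {\<omega> \<in> space M. Y \<omega> \<le> v} = measure (distr M borel Y) {..v}"
    by (subst measure_distr) (auto intro!: arg_cong[where f = prob])
  then have "prob {\<omega> \<in> space M. Y \<omega> \<le> v} = Phi v"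
    using gaussian_pair_marginals(2)[OF G moments] by (simp add: Phi_def cdf_def)
  moreover have "prob {\<omega> \<in> space M. Y \<omega> \<le> v} = prob {\<omega> \<in> space M. X \<omega> \<le> u \<and> Y \<omega> \<le> v}
      + prob {\<omega> \<in> space M. u < X \<omega> \<and> Y \<omega> \<le> v}"
    by (subst finite_measure_Union[symmetric]) (auto intro!: arg_cong[where f = prob])
  ultimately show ?thesis
    using gaussian_pair_prob[OF G moments cov r, of u v] normal_tail_integral[of v]
    by (simp add: joint_exceedance_def)
qed

text \<open>Both maxima obey their bounds exactly when every vector of the row lies in one quadrant,
  so independence gives a product of n equal factors.\<close>

lemma (in prob_space) gaussian_array_maxima_cdf:
  assumes A: "gaussian_array M X Y \<rho>" and n: "n \<ge> 1" and r: "\<bar>\<rho> n\<bar> < 1"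
  shows "prob {\<omega> \<in> space M. row_max X n \<omega> \<le> u \<and> row_max Y n \<omega> \<le> v}
    = (1 - joint_exceedance (\<rho> n) u v) ^ n"
proof -
  have ind: "indep_vars (\<lambda>_. borel) (\<lambda>i \<omega>. (X n i \<omega>, Y n i \<omega>)) {1..n}"
    using A n by (auto simp: gaussian_array_def)
  have "{..u} \<times> {..v} \<in> sets (borel :: (real \<times> real) measure)"
    by (intro borel_closed closed_Times closed_atMost)
  then have "prob (\<Inter>i\<in>{1..n}. (\<lambda>\<omega>. (X n i \<omega>, Y n i \<omega>)) -` ({..u} \<times> {..v}) \<inter> space M)
      = (\<Prod>i\<in>{1..n}. prob ((\<lambda>\<omega>. (X n i \<omega>, Y n i \<omega>)) -` ({..u} \<times> {..v}) \<inter> space M))"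
    using n by (intro indep_varsD_finite[OF ind]) auto
  also have "(\<Inter>i\<in>{1..n}. (\<lambda>\<omega>. (X n i \<omega>, Y n i \<omega>)) -` ({..u} \<times> {..v}) \<inter> space M)
      = {\<omega> \<in> space M. row_max X n \<omega> \<le> u \<and> row_max Y n \<omega> \<le> v}"
    using n by (auto simp: row_max_le_iff)
  also have "(\<Prod>i\<in>{1..n}. prob ((\<lambda>\<omega>. (X n i \<omega>, Y n i \<omega>)) -` ({..u} \<times> {..v}) \<inter> space M))
      = (\<Prod>i\<in>{1..n}. 1 - joint_exceedance (\<rho> n) u v)"
  proof (rule prod.cong)
    fix i assume i: "i \<in> {1..n}"
    have "(\<lambda>\<omega>. (X n i \<omega>, Y n i \<omega>)) -` ({..u} \<times> {..v}) \<inter> space M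
        = {\<omega> \<in> space M. X n i \<omega> \<le> u \<and> Y n i \<omega> \<le> v}" by auto
    then show "prob ((\<lambda>\<omega>. (X n i \<omega>, Y n i \<omega>)) -` ({..u} \<times> {..v}) \<inter> space M)
        = 1 - joint_exceedance (\<rho> n) u v"
      using gaussian_pair_cdf[OF gaussian_array_pair[OF A i] r] by simp
  qed simp
  finally show ?thesis by simp
qed

text \<open>The first term contributes \<open>exp (- y)\<close>, which cancels the last summand of
  \<open>husler_reiss_tail_integral\<close>. What remains is the symmetric exponent of the limit
  law.\<close>

lemma joint_exceedance_tendsto:
  fixes b u v \<rho> :: "nat \<Rightarrow> real"
  assumes b: "\<And>n. n \<ge> 2 \<Longrightarrow> 1 - Phi (b n) = 1 / real n"
    and u: "(\<lambda>n. b n * (u n - b n)) \<longlonglongrightarrow> x" and v: "(\<lambda>n. b n * (v n - b n)) \<longlonglongrightarrow> y"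
    and l: "l > 0" and \<rho>: "(\<lambda>n. (b n)\<^sup>2 * (1 - \<rho> n)) \<longlonglongrightarrow> 2 * l\<^sup>2" and \<rho>1: "\<rho> \<longlonglongrightarrow> 1"
  shows "(\<lambda>n. real n * joint_exceedance (\<rho> n) (u n) (v n))
    \<longlonglongrightarrow> Phi (l + (x - y) / (2 * l)) * exp (- y) + Phi (l + (y - x) / (2 * l)) * exp (- x)"
proof -
  have "(\<lambda>n. real n * (LINT p|lborel. indicator {v n<..} p * (std_normal_density p * 1)))
      \<longlonglongrightarrow> (LINT z|lborel. indicator {y<..} z * (exp (- z) * 1))"
    by (rule quantile_tail_tendsto[OF b v]) auto
  then have 1: "(\<lambda>n. real n * (LINT p|lborel. indicator {v n<..} p * std_normal_density p)) \<longlonglongrightarrow> exp (- y)"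
    using has_bochner_integral_integral_eq[OF exp_tail_has_bochner_integral[of y]] by simp
  have 2: "(\<lambda>n. real n * (LINT p|lborel. indicator {u n<..} p *
        (std_normal_density p * Phi ((v n - \<rho> n * p) / sqrt (1 - (\<rho> n)\<^sup>2)))))
      \<longlonglongrightarrow> (LINT z|lborel. indicator {x<..} z * (exp (- z) * Phi (l + (y - z) / (2 * l))))"
  proof (rule quantile_tail_tendsto[OF b u])
    show "(\<lambda>n. Phi ((v n - \<rho> n * (b n + z / b n)) / sqrt (1 - (\<rho> n)\<^sup>2))) \<longlonglongrightarrow> Phi (l + (y - z) / (2 * l))" for z
      using conditional_argument_tendsto[OF quantile_at_top[OF b] l \<rho> \<rho>1 v]
      by (rule isCont_tendsto_compose[OF isCont_Phi])
  qed (auto simp: Phi_bounds)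
  show ?thesis
    using tendsto_add[OF 1 2] unfolding husler_reiss_tail_integral[OF l]
    by (simp add: joint_exceedance_def distrib_left)
qed

theorem theorem2p1:
  fixes M :: "'a measure"
    and X Y :: "nat \<Rightarrow> nat \<Rightarrow> 'a \<Rightarrow> real"
    and \<rho> b c d :: "nat \<Rightarrow> real"
    and t l x y :: real
  assumes "prob_space M"
    and "gaussian_array M X Y \<rho>"
    and "\<And>n. n \<ge> 2 \<Longrightarrow> 1 - Phi (b n) = 1 / real n"
    and "t > 0"
    and "\<And>n. n \<ge> 2 \<Longrightarrow> c n = t * b n powr (t - 2)"
    and "\<And>n. n \<ge> 2 \<Longrightarrow> d n = b n powr t"
    and "l > 0"
    and "(\<lambda>n. (b n)\<^sup>2 * (1 - \<rho> n)) \<longlonglongrightarrow> 2 * l\<^sup>2"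
  shows "(\<lambda>n. measure M {\<omega> \<in> space M.
             \<bar>row_max X n \<omega>\<bar> powr t \<le> c n * x + d n \<and>
             \<bar>row_max Y n \<omega>\<bar> powr t \<le> c n * y + d n})
         \<longlonglongrightarrow> husler_reiss l x y"
proof -
  interpret prob_space M by fact
  note A = assms(2) and b = assms(3) and t = assms(4) and l = assms(7) and \<rho> = assms(8)
  have b_top: "filterlim b at_top sequentially" using b by (rule quantile_at_top)
  \<comment> \<open>The thresholds are built from the formulas for the norming constants, since
    \<open>c\<close> and \<open>d\<close> are prescribed only from n = 2 on; \<open>u\<close> is the
    corresponding t-th root.\<close>
  define r where "r w n = t * b n powr (t - 2) * w + b n powr t" for w n
  define u where "u w n = r w n powr (1 / t)" for w n
  have u: "(\<lambda>n. b n * (u w n - b n)) \<longlonglongrightarrow> w"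
    and u_top: "filterlim (u w) at_top sequentially"
    and r_pos: "eventually (\<lambda>n. r w n > 0) sequentially" for w
    using filterlim_compose[OF power_threshold_asymptotics(1)[OF t] b_top]
      filterlim_compose[OF power_threshold_asymptotics(2)[OF t] b_top]
      eventually_compose_filterlim[OF power_threshold_asymptotics(3)[OF t] b_top]
    unfolding u_def r_def by auto
  have "((\<lambda>z::real. inverse (z\<^sup>2)) \<longlongrightarrow> 0) at_top" by real_asymp
  then have inv: "(\<lambda>n. inverse ((b n)\<^sup>2)) \<longlonglongrightarrow> 0"
    using b_top by (rule filterlim_compose)
  \<comment> \<open>The correlation is recovered from the convergent quantity by dividing out the
    square of \<open>b n\<close>, hence tends to 1.\<close>
  have "(\<lambda>n. 1 - (b n)\<^sup>2 * (1 - \<rho> n) * inverse ((b n)\<^sup>2)) \<longlonglongrightarrow> 1 - 2 * l\<^sup>2 * 0"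
    by (intro tendsto_diff tendsto_const tendsto_mult[OF \<rho> inv])
  moreover have b_pos: "eventually (\<lambda>n. b n > 0) sequentially"
    using b_top by (simp add: filterlim_at_top_dense)
  then have "eventually (\<lambda>n. 1 - (b n)\<^sup>2 * (1 - \<rho> n) * inverse ((b n)\<^sup>2) = \<rho> n) sequentially"
    by eventually_elim (simp add: field_simps)
  ultimately have \<rho>1: "\<rho> \<longlonglongrightarrow> 1"
    using Lim_transform_eventually by fastforce
  \<comment> \<open>Positivity of the limit 2 l^2 excludes \<open>\<rho> n\<close> = 1 for large n,
    so the nondegenerate formulas eventually apply.\<close>
  have "eventually (\<lambda>n. (b n)\<^sup>2 * (1 - \<rho> n) > 0) sequentially"
    using \<rho> by (rule order_tendstoD) (use l in simp)
  moreover have "eventually (\<lambda>n. \<rho> n > 0) sequentially"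
    using \<rho>1 by (rule order_tendstoD) simp
  ultimately have \<rho>_bound: "eventually (\<lambda>n. \<bar>\<rho> n\<bar> < 1) sequentially"
    by eventually_elim (auto simp: zero_less_mult_iff)
  define a where "a = Phi (l + (x - y) / (2 * l)) * exp (- y) + Phi (l + (y - x) / (2 * l)) * exp (- x)"
  define F where "F n = prob {\<omega> \<in> space M. row_max X n \<omega> \<le> u x n \<and> row_max Y n \<omega> \<le> u y n}" for n
  define G where "G n = prob {\<omega> \<in> space M.
             \<bar>row_max X n \<omega>\<bar> powr t \<le> c n * x + d n \<and>
             \<bar>row_max Y n \<omega>\<bar> powr t \<le> c n * y + d n}" for n
  \<comment> \<open>The default 0 keeps \<open>q n\<close> in the unit interval at all indices, as
    \<open>power_tendsto_exp_minus\<close> requires; it does not affect the limit.\<close>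
  define q where "q n = (if n \<ge> 1 \<and> \<bar>\<rho> n\<bar> < 1 then joint_exceedance (\<rho> n) (u x n) (u y n) else 0)" for n
  have q_range: "0 \<le> q n \<and> q n \<le> 1" for n
  proof (cases "n \<ge> 1 \<and> \<bar>\<rho> n\<bar> < 1")
    case True
    then have i: "1 \<in> {1..n}" by simp
    from True have "\<bar>\<rho> n\<bar> < 1" by simp
    from gaussian_pair_cdf[OF gaussian_array_pair[OF A i] this, of "u x n" "u y n"] True
    show ?thesis
      using prob_le_1[of "{\<omega> \<in> space M. X n 1 \<omega> \<le> u x n \<and> Y n 1 \<omega> \<le> u y n}"]
        measure_nonneg[of M "{\<omega> \<in> space M. X n 1 \<omega> \<le> u x n \<and> Y n 1 \<omega> \<le> u y n}"]
      unfolding q_def by simp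
  qed (auto simp: q_def)
  have good: "eventually (\<lambda>n. n \<ge> 1 \<and> \<bar>\<rho> n\<bar> < 1) sequentially"
    using \<rho>_bound eventually_ge_at_top[of 1] by eventually_elim simp
  have "(\<lambda>n. real n * joint_exceedance (\<rho> n) (u x n) (u y n)) \<longlonglongrightarrow> a"
    unfolding a_def by (rule joint_exceedance_tendsto[OF b u u l \<rho> \<rho>1])
  moreover have "eventually (\<lambda>n. real n * joint_exceedance (\<rho> n) (u x n) (u y n) = real n * q n) sequentially"
    using good by eventually_elim (simp add: q_def)
  ultimately have "(\<lambda>n. real n * q n) \<longlonglongrightarrow> a"
    by (rule Lim_transform_eventually)
  then have "(\<lambda>n. (1 - q n) ^ n) \<longlonglongrightarrow> exp (- a)"
    using q_range by (intro power_tendsto_exp_minus) auto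
  moreover have "eventually (\<lambda>n. (1 - q n) ^ n = F n) sequentially"
    using good by eventually_elim (simp add: F_def q_def gaussian_array_maxima_cdf[OF A])
  ultimately have F: "F \<longlonglongrightarrow> exp (- a)"
    by (rule Lim_transform_eventually)
  \<comment> \<open>The events behind \<open>F\<close> and \<open>G\<close> can differ only if a row
    maximum lies below minus its threshold. The first entry of that row then does too, which bounds
    the gap by two marginal lower tails tending to 0.\<close>
  have "eventually (\<lambda>n. norm (G n - F n) \<le> Phi (- u x n) + Phi (- u y n)) sequentially"
    using r_pos[of x] r_pos[of y] eventually_ge_at_top[of 2]
  proof eventually_elim
    fix n :: nat assume pos: "0 < r x n" "0 < r y n" and n: "2 \<le> n"
    have i: "1 \<in> {1..n}" using n by simp
    note pair = gaussian_array_pair[OF A i]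
    have [measurable]: "X n j \<in> borel_measurable M" "Y n j \<in> borel_measurable M" if "j \<in> {1..n}" for j
      using gaussian_pair_measurable[OF gaussian_array_pair(1)[OF A that]] by auto
    note [measurable] = gaussian_pair_measurable[OF pair(1)]
      gaussian_pair_measurable[OF pair(1), unfolded One_nat_def]
    have [measurable]: "row_max X n \<in> borel_measurable M" "row_max Y n \<in> borel_measurable M"
      unfolding row_max_def[abs_def] by measurable
    let ?E = "{\<omega> \<in> space M. \<bar>row_max X n \<omega>\<bar> \<le> u x n \<and> \<bar>row_max Y n \<omega>\<bar> \<le> u y n}"
    let ?F = "{\<omega> \<in> space M. row_max X n \<omega> \<le> u x n \<and> row_max Y n \<omega> \<le> u y n}"
    let ?A = "{\<omega> \<in> space M. X n 1 \<omega> \<le> - u x n}" and ?B = "{\<omega> \<in> space M. Y n 1 \<omega> \<le> - u y n}"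
    have GE: "G n = prob ?E"
      using n pos by (simp add: G_def assms(5,6) r_def[symmetric] u_def abs_powr_le_iff[OF t])
    have "prob ?A = measure (distr M borel (X n 1)) {..- u x n}"
      by (subst measure_distr) (auto intro!: arg_cong[where f = prob])
    then have PA: "prob ?A = Phi (- u x n)"
      using gaussian_pair_marginals(1)[OF pair(1-5)] by (simp add: Phi_def cdf_def)
    have "prob ?B = measure (distr M borel (Y n 1)) {..- u y n}"
      by (subst measure_distr) (auto intro!: arg_cong[where f = prob])
    then have PB: "prob ?B = Phi (- u y n)"
      using gaussian_pair_marginals(2)[OF pair(1-5)] by (simp add: Phi_def cdf_def)
    have "prob ?E \<le> prob ?F"
      by (rule finite_measure_mono) auto
    moreover have "prob ?F \<le> prob (?E \<union> (?A \<union> ?B))"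
    proof (rule finite_measure_mono)
      show "?F \<subseteq> ?E \<union> (?A \<union> ?B)"
      proof
        fix \<omega> assume "\<omega> \<in> ?F"
        then show "\<omega> \<in> ?E \<union> (?A \<union> ?B)"
          using row_max_ge[of n X \<omega>] row_max_ge[of n Y \<omega>] n
          by (auto simp: abs_le_iff simp del: One_nat_def)
      qed
    qed measurable
    moreover have "prob (?E \<union> (?A \<union> ?B)) \<le> prob ?E + (prob ?A + prob ?B)"
      by (intro order_trans[OF measure_Un_le] add_left_mono measure_Un_le) measurable
    ultimately show "norm (G n - F n) \<le> Phi (- u x n) + Phi (- u y n)"
      unfolding GE F_def PA PB by simp
  qed
  moreover have "(\<lambda>n. Phi (- u w n)) \<longlonglongrightarrow> 0" for w
    using u_top by (intro filterlim_compose[OF Phi_at_bot]) (simp add: filterlim_uminus_at_bot)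
  then have "(\<lambda>n. Phi (- u x n) + Phi (- u y n)) \<longlonglongrightarrow> 0"
    using tendsto_add by fastforce
  ultimately have "(\<lambda>n. G n - F n) \<longlonglongrightarrow> 0"
    by (rule Lim_null_comparison)
  from tendsto_add[OF this F] have "G \<longlonglongrightarrow> exp (- a)" by simp
  then show ?thesis
    by (simp add: G_def[abs_def] a_def husler_reiss_def)
qed

end
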